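(* Let $n\ge4$ be even and let $F$ be a field of characteristic $\neq2$. Let $L_{n+1}$ be the simple $(n+1)$-dimensional $n$-Lie algebra over $F$ with basis $e_1,\dots,e_{n+1}$ and $[e_1,\dots,\widehat{e}_i,\dots,e_{n+1}]=(-1)^{n+i+1}e_i$ for $1\le i\le n+1$. Then there exists an associative algebra $A$ over $F$ such that $L_{n+1}$ is isomorphic (as an $n$-ary algebra) to a subalgebra of $A^-$.
   Context: An $n$-Lie algebra is a vector space over a field of characteristic $\neq2$ with a multilinear alternating operation $[z_1,\dots,z_n]$ (permuting arguments by $\sigma$ multiplies by the sign $\epsilon(\sigma)$) satisfying $[[z_1,\dots,z_n],w_2,\dots,w_n]=\sum_{i=1}^n[z_1,\dots,[z_i,w_2,\dots,w_n],\dots,z_n]$. A hat means the entry is omitted. For an associative algebra $A$, $A^-$ denotes the alternating $n$-ary algebra with underlying vector space $A$ and operation $\mathrm{alt}(z_1,\dots,z_n)=\sum_{\sigma\in S_n}\epsilon(\sigma)z_{\sigma(1)}\cdots z_{\sigma(n)}$; a subalgebra of $A^-$ is a subspace closed under this operation. *)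

theory Defs
  imports
    "HOL-Algebra.Module"
    "HOL-Algebra.Algebraic_Closure_Type"
    "HOL-Combinatorics.Permutations"
begin

section \<open>n-Lie algebras\<close>

text \<open>
  An n-ary operation is a function on lists, of which only the values on lists of length n matter;
  the entry z_i of the mathematical notation is the list entry with index i - 1.
  Skew-symmetry is stated through the sign of the permutation, which in characteristic different
  from 2 makes the operation vanish on lists with a repeated entry.
\<close>

locale n_lie_algebra = vector_space scale
  for scale :: "'f::field \<Rightarrow> 'v::ab_group_add \<Rightarrow> 'v" +
  fixes n :: nat and br :: "'v list \<Rightarrow> 'v"
  assumes char_neq_2: "CHAR('f) \<noteq> 2"
    and multilinear:
      "\<And>zs i x y a b. length zs = n \<Longrightarrow> i < n \<Longrightarrow>
         br (zs[i := scale a x + scale b y]) = scale a (br (zs[i := x])) + scale b (br (zs[i := y]))"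
    and skew:
      "\<And>zs \<sigma>. length zs = n \<Longrightarrow> \<sigma> permutes {..<n} \<Longrightarrow>
         br (permute_list \<sigma> zs) = scale (of_int (sign \<sigma>)) (br zs)"
    and n_jacobi:
      "\<And>zs ws. length zs = n \<Longrightarrow> length ws = n - 1 \<Longrightarrow>
         br (br zs # ws) = (\<Sum>i<n. br (zs[i := br (zs ! i # ws)]))"
begin

definition ideal :: "'v set \<Rightarrow> bool" where
  "ideal I \<longleftrightarrow> subspace I \<and> (\<forall>zs. length zs = n \<and> set zs \<inter> I \<noteq> {} \<longrightarrow> br zs \<in> I)"

definition simple :: bool where
  "simple \<longleftrightarrow> (\<exists>zs. length zs = n \<and> br zs \<noteq> 0) \<and> (\<forall>I. ideal I \<longrightarrow> I = {0} \<or> I = UNIV)"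

end

section \<open>Associative algebras and their alternating n-ary algebras\<close>

text \<open>
  The locale \<open>algebra\<close> of HOL-Algebra is commutative, so it cannot be used here.
  The field of scalars is a type of class \<open>field\<close>, seen as a ring record.
  Algebras have a unit; this is no restriction on the existence of an embedding into an alternating
  algebra, as an algebra without unit embeds into its unitization.
\<close>

locale assoc_algebra =
  Module.module "ring_of_type_algebra :: 'f::field ring" A + ring A
  for A :: "('f::field, 'a) module" (structure) +
  assumes smult_mult_left:
      "\<lbrakk>x \<in> carrier A; y \<in> carrier A\<rbrakk> \<Longrightarrow> (c \<odot> x) \<otimes> y = c \<odot> (x \<otimes> y)"
    and smult_mult_right:
      "\<lbrakk>x \<in> carrier A; y \<in> carrier A\<rbrakk> \<Longrightarrow> x \<otimes> (c \<odot> y) = c \<odot> (x \<otimes> y)"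

definition alt :: "('f::field, 'a) module \<Rightarrow> 'a list \<Rightarrow> 'a" where
  "alt A zs =
     (\<Oplus>\<^bsub>A\<^esub>\<sigma>\<in>{\<sigma>. \<sigma> permutes {..<length zs}}.
        of_int (sign \<sigma>) \<odot>\<^bsub>A\<^esub> foldr (\<lambda>x y. x \<otimes>\<^bsub>A\<^esub> y) (permute_list \<sigma> zs) \<one>\<^bsub>A\<^esub>)"

definition minus_subalgebra :: "nat \<Rightarrow> ('f::field, 'a) module \<Rightarrow> 'a set \<Rightarrow> bool" where
  "minus_subalgebra n A S \<longleftrightarrow>
     submodule S (ring_of_type_algebra :: 'f ring) A \<and>
     (\<forall>zs. length zs = n \<and> set zs \<subseteq> S \<longrightarrow> alt A zs \<in> S)"

text \<open>Isomorphisms from an n-ary algebra on a whole type onto a subalgebra S of the alternating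
  n-ary algebra of A:\<close>

definition n_ary_iso ::
  "nat \<Rightarrow> ('f::field \<Rightarrow> 'v::ab_group_add \<Rightarrow> 'v) \<Rightarrow> ('v list \<Rightarrow> 'v) \<Rightarrow>
    ('f, 'a) module \<Rightarrow> 'a set \<Rightarrow> ('v \<Rightarrow> 'a) \<Rightarrow> bool" where
  "n_ary_iso n scale br A S \<phi> \<longleftrightarrow>
     bij_betw \<phi> UNIV S \<and>
     (\<forall>x y. \<phi> (x + y) = \<phi> x \<oplus>\<^bsub>A\<^esub> \<phi> y) \<and>
     (\<forall>c x. \<phi> (scale c x) = c \<odot>\<^bsub>A\<^esub> \<phi> x) \<and>
     (\<forall>zs. length zs = n \<longrightarrow> \<phi> (br zs) = alt A (map \<phi> zs))"

text \<open>
  Types cannot be quantified existentially, so ``there is an associative algebra over the field''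
  means: there is one whose carrier is a subset of the following type. For embeddings of a
  finite-dimensional n-ary algebra this is no restriction: the subalgebra generated by the
  (finitely many) images of basis vectors is spanned by words in them, hence isomorphic, as a
  vector space, to a space of functions from words to the field; and such functions embed into
  this type, for instance as constant functions.
\<close>

type_synonym 'f alg_universe = "(nat list \<Rightarrow> 'f) \<Rightarrow> nat list \<Rightarrow> 'f"

end

theory Submission
  imports Defs
begin

text \<open>
  Write \<open>z\<close> for the word \<open>x\<^sub>1 x\<^sub>2 \<dots> x\<^sub>n\<^sub>+\<^sub>1\<close> of odd length and \<open>w\<^sub>k\<close> for
  \<open>z\<close> without its \<open>k\<close>-th letter. The algebra wanted is, in essence, the universal one: the free
  associative algebra modulo the \<open>n + 1\<close> relations that say that the alternating sum of the
  rearrangements of \<open>w\<^sub>k\<close> is \<open>\<plusminus>x\<^sub>k\<close>. The bracket of the \<open>n\<close>-Lie algebra and the alternating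
  operation are both multilinear and alternating, so agreement on the words \<open>w\<^sub>k\<close> makes the evident
  linear map a homomorphism (\<open>skew_multilinear_eq_0\<close>). What must be proved is that the
  generators stay linearly independent in this algebra.

  Instead of a quotient of the free algebra, the proof uses its dual space: functions
  \<open>f\<close> on words that satisfy all relations \<open>\<Sum>\<^sub>\<sigma> sign \<sigma> f (p \<sigma>(w\<^sub>k) q) = \<plusminus>f (p x\<^sub>k q)\<close>. The
  letter \<open>a\<close> acts on this space \<open>M\<close> by \<open>f \<mapsto> (u \<mapsto> f (u a))\<close>, the relations hold for these
  operators by the choice of \<open>M\<close>, and the algebra is that of all linear operators on \<open>M\<close>. The
  letters are independent as soon as some \<open>f\<close> in \<open>M\<close> takes prescribed values on the
  one-letter words.

  Such an \<open>f\<close> is built by recursion (\<open>extend_from_irreducible_words\<close>), a dual form of Bergman's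
  diamond lemma. Among the rearrangements of \<open>w\<^sub>k\<close> the increasing one, \<open>w\<^sub>k\<close> itself, has the most
  noninversions, so a relation determines \<open>f (p w\<^sub>k q)\<close> from the values at words that are shorter, or equally
  long with fewer noninversions. A word containing two of the factors \<open>w\<^sub>i\<close>, \<open>w\<^sub>j\<close> gets its value in two
  ways, which must agree (\<open>confluence\<close>). If the factors are disjoint, this is an exchange of two sums.
  Two such factors overlap only inside one copy of \<open>z\<close>, the first without the last letter and the second
  without the first. There the alternating sum over the rearrangements of \<open>z\<close> can be expanded
  along the first or along the last letter; as \<open>z\<close> has odd length, the signs
  of both expansions coincide (\<open>signed_sum_Laplace_exchange\<close>), and the corresponding right sides
  \<open>\<plusminus>f (p x\<^sub>k x\<^sub>k q)\<close> agree because \<open>x\<^sub>k\<close> commutes with itself. This is where \<open>n\<close> is even.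
\<close>

section \<open>Alternating sums over the rearrangements of a word\<close>

definition signed_sum :: "('a list \<Rightarrow> 'f::comm_ring_1) \<Rightarrow> 'a list \<Rightarrow> 'f" where
  "signed_sum g z =
     (\<Sum>\<sigma> | \<sigma> permutes {..<length z}. of_int (sign \<sigma>) * g (permute_list \<sigma> z))"

lemma permutation_of_permutes_lessThan: "\<sigma> permutes {..<n::nat} \<Longrightarrow> permutation \<sigma>"
  by (auto simp: permutation_permutes)

lemma of_int_sign_left_idempotent [simp]:
  "of_int (sign p) * (of_int (sign p) * x) = (x::'f::comm_ring_1)"
  by (cases p rule: sign_cases) simp_all

lemma signed_sum_permute_list:
  fixes g :: "'a list \<Rightarrow> 'f::comm_ring_1"
  assumes \<tau>: "\<tau> permutes {..<length z}"
  shows "signed_sum g (permute_list \<tau> z) = of_int (sign \<tau>) * signed_sum g z"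
proof -
  have "signed_sum g z =
      (\<Sum>\<sigma> | \<sigma> permutes {..<length z}. of_int (sign (\<tau> \<circ> \<sigma>)) * g (permute_list (\<tau> \<circ> \<sigma>) z))"
    unfolding signed_sum_def by (rule setum_permutations_compose_left[OF \<tau>])
  also have "\<dots> = (\<Sum>\<sigma> | \<sigma> permutes {..<length z}.
      of_int (sign \<tau>) * (of_int (sign \<sigma>) * g (permute_list \<sigma> (permute_list \<tau> z))))"
    by (rule sum.cong)
       (auto simp: sign_compose permutation_of_permutes_lessThan[OF \<tau>]
         permutation_of_permutes_lessThan permute_list_compose mult.assoc)
  finally show ?thesis
    by (simp add: signed_sum_def flip: sum_distrib_left)
qed

lemma signed_sum_comp_permute_list:
  fixes g :: "'a list \<Rightarrow> 'f::comm_ring_1"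
  assumes \<tau>: "\<tau> permutes {..<length z}"
  shows "signed_sum (\<lambda>w. g (permute_list \<tau> w)) z = of_int (sign \<tau>) * signed_sum g z"
proof -
  have "signed_sum g z =
      (\<Sum>\<sigma> | \<sigma> permutes {..<length z}. of_int (sign (\<sigma> \<circ> \<tau>)) * g (permute_list (\<sigma> \<circ> \<tau>) z))"
    unfolding signed_sum_def by (rule sum_permutations_compose_right[OF \<tau>])
  also have "\<dots> = (\<Sum>\<sigma> | \<sigma> permutes {..<length z}.
      of_int (sign \<tau>) * (of_int (sign \<sigma>) * g (permute_list \<tau> (permute_list \<sigma> z))))"
    by (rule sum.cong)
       (auto simp: sign_compose permutation_of_permutes_lessThan[OF \<tau>]
         permutation_of_permutes_lessThan permute_list_compose \<tau> mult_ac)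
  finally show ?thesis
    by (simp add: signed_sum_def flip: sum_distrib_left)
qed

text \<open>
  The cycle that brings position \<open>k\<close> to the front and keeps the order of the other positions.
\<close>

fun front_cycle :: "nat \<Rightarrow> nat \<Rightarrow> nat" where
  "front_cycle 0 = id"
| "front_cycle (Suc k) = transpose k (Suc k) \<circ> front_cycle k"

lemma front_cycle_permutes: "k < m \<Longrightarrow> front_cycle k permutes {..<m}"
  by (induction k) (auto intro!: permutes_compose permutes_swap_id permutes_id)

lemma front_cycle_apply:
  "front_cycle k i = (if i = 0 then k else if i \<le> k then i - 1 else i)"
  by (induction k) (auto simp: transpose_def)

lemma sign_front_cycle: "sign (front_cycle k) = (-1) ^ k"
proof (induction k)
  case (Suc k)
  have "permutation (front_cycle k)"
    using front_cycle_permutes[of k "Suc k"] by (rule permutation_of_permutes_lessThan) simp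
  then show ?case
    using Suc by (simp add: sign_compose permutation_swap_id sign_swap_id del: o_apply)
qed simp

definition remove_nth :: "nat \<Rightarrow> 'a list \<Rightarrow> 'a list" where
  "remove_nth k z = take k z @ drop (Suc k) z"

lemma length_remove_nth [simp]: "k < length z \<Longrightarrow> length (remove_nth k z) = length z - 1"
  by (simp add: remove_nth_def)

lemma permute_list_front_cycle:
  assumes "k < length z"
  shows "permute_list (front_cycle k) z = z ! k # remove_nth k z"
proof (rule nth_equalityI)
  fix i assume "i < length (permute_list (front_cycle k) z)"
  with assms show "permute_list (front_cycle k) z ! i = (z ! k # remove_nth k z) ! i"
    by (cases i) (auto simp: permute_list_nth front_cycle_permutes front_cycle_apply
        remove_nth_def nth_append min_def)
qed (use assms in simp)

definition lift_perm :: "nat \<Rightarrow> (nat \<Rightarrow> nat) \<Rightarrow> nat \<Rightarrow> nat" where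
  "lift_perm m = map_permutation {..<m} Suc"

lemma lift_perm_permutes:
  assumes "\<sigma> permutes {..<m}" shows "lift_perm m \<sigma> permutes {1..<Suc m}"
  unfolding lift_perm_def using assms
  by (intro map_permutation_permutes[of _ "{..<m}"])
     (auto simp: bij_betw_def image_Suc_lessThan)

lemma permute_list_lift_perm:
  assumes "\<sigma> permutes {..<length w}"
  shows "permute_list (lift_perm (length w) \<sigma>) (a # w) = a # permute_list \<sigma> w"
proof (rule nth_equalityI)
  fix i assume i: "i < length (permute_list (lift_perm (length w) \<sigma>) (a # w))"
  have 0: "lift_perm (length w) \<sigma> 0 = 0"
    using lift_perm_permutes[OF assms] by (auto simp: permutes_def)
  have p: "lift_perm (length w) \<sigma> permutes {..<length (a # w)}"
    using lift_perm_permutes[OF assms] by (rule permutes_subset) auto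
  show "permute_list (lift_perm (length w) \<sigma>) (a # w) ! i = (a # permute_list \<sigma> w) ! i"
  proof (cases i)
    case (Suc j)
    with i have "lift_perm (length w) \<sigma> (Suc j) = Suc (\<sigma> j)"
      unfolding lift_perm_def by (intro map_permutation_apply) auto
    with Suc i p assms show ?thesis
      by (simp add: permute_list_nth)
  qed (use p 0 in \<open>simp add: permute_list_nth\<close>)
qed simp

text \<open>
  The position \<open>k\<close> whose entry is moved to the front indexes the cosets of the stabilizer of
  position 0, and \<open>front_cycle k\<close> is a representative of its coset.
\<close>

lemma bij_betw_permutes_front_cycle:
  "bij_betw (\<lambda>(k, \<sigma>). front_cycle k \<circ> lift_perm m \<sigma>)
     ({..m} \<times> {\<sigma>. \<sigma> permutes {..<m}}) {\<pi>. \<pi> permutes {..<Suc m}}"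
proof (rule bij_betw_byWitness)
  let ?f = "\<lambda>(k, \<sigma>). front_cycle k \<circ> lift_perm m \<sigma>"
  let ?unlift = "\<lambda>\<rho>. map_permutation {1..<Suc m} (inv_into {..<m} Suc) \<rho>"
  let ?g = "\<lambda>\<pi>. (\<pi> 0, ?unlift (Hilbert_Choice.inv (front_cycle (\<pi> 0)) \<circ> \<pi>))"
  have b: "bij_betw Suc {..<m} {1..<Suc m}"
    by (auto simp: bij_betw_def image_Suc_lessThan)
  have bi: "bij_betw (inv_into {..<m} Suc) {1..<Suc m} {..<m}"
    using b by (rule bij_betw_inv_into)
  have fp: "front_cycle k permutes UNIV" for k
    using front_cycle_permutes[of k "Suc k"] by (rule permutes_subset) auto
  have lp: "lift_perm m \<sigma> permutes {1..<Suc m}" if "\<sigma> permutes {..<m}" for \<sigma>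
    using lift_perm_permutes[OF that] .
  show "\<forall>a\<in>{..m} \<times> {\<sigma>. \<sigma> permutes {..<m}}. ?g (?f a) = a"
  proof
    fix a assume "a \<in> {..m} \<times> {\<sigma>. \<sigma> permutes {..<m}}"
    then obtain k \<sigma> where a: "a = (k, \<sigma>)" and \<sigma>: "\<sigma> permutes {..<m}"
      by auto
    have "lift_perm m \<sigma> 0 = 0"
      using lp[OF \<sigma>] by (auto simp: permutes_def)
    then have 0: "(front_cycle k \<circ> lift_perm m \<sigma>) 0 = k"
      by (simp add: front_cycle_apply)
    have "Hilbert_Choice.inv (front_cycle k) \<circ> (front_cycle k \<circ> lift_perm m \<sigma>) = lift_perm m \<sigma>"
      using permutes_inv_o(2)[OF fp[of k]] by (simp flip: comp_assoc)
    moreover have "?unlift (lift_perm m \<sigma>) = \<sigma>"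
      unfolding lift_perm_def
      by (rule map_permutation_compose_inv[OF b \<sigma>]) auto
    ultimately have "?g (front_cycle k \<circ> lift_perm m \<sigma>) = (k, \<sigma>)"
      using 0 by metis
    then show "?g (?f a) = a"
      by (simp only: a prod.case)
  qed
  have un: "?unlift (Hilbert_Choice.inv (front_cycle (\<pi> 0)) \<circ> \<pi>) permutes {..<m}
       \<and> lift_perm m (?unlift (Hilbert_Choice.inv (front_cycle (\<pi> 0)) \<circ> \<pi>)) = Hilbert_Choice.inv (front_cycle (\<pi> 0)) \<circ> \<pi>
       \<and> \<pi> 0 \<le> m"
    if \<pi>: "\<pi> permutes {..<Suc m}" for \<pi>
  proof -
    have le: "\<pi> 0 \<le> m"
      using permutes_in_image[OF \<pi>, of 0] by auto
    have *: "Hilbert_Choice.inv (front_cycle (\<pi> 0)) \<circ> \<pi> permutes {..<Suc m}"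
      by (intro permutes_compose[OF \<pi>] permutes_inv front_cycle_permutes) (use le in auto)
    have "Hilbert_Choice.inv (front_cycle (\<pi> 0)) (\<pi> 0) = 0"
      using permutes_inv_eq[OF fp[of "\<pi> 0"]] by (simp add: front_cycle_apply)
    then have **: "Hilbert_Choice.inv (front_cycle (\<pi> 0)) \<circ> \<pi> permutes {1..<Suc m}"
      by (intro permutes_superset[OF *]) (auto simp: Suc_le_eq less_Suc_eq_0_disj)
    show ?thesis
      using map_permutation_permutes[OF bi **] map_permutation_compose_inv[OF bi **, of Suc] le
      by (auto simp: lift_perm_def f_inv_into_f image_Suc_lessThan)
  qed
  show "\<forall>\<pi>\<in>{\<pi>. \<pi> permutes {..<Suc m}}. ?f (?g \<pi>) = \<pi>"
  proof
    fix \<pi> assume "\<pi> \<in> {\<pi>. \<pi> permutes {..<Suc m}}"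
    then have \<pi>: "\<pi> permutes {..<Suc m}"
      by simp
    have "front_cycle (\<pi> 0) \<circ> (Hilbert_Choice.inv (front_cycle (\<pi> 0)) \<circ> \<pi>) = \<pi>"
      using permutes_inv_o(1)[OF fp[of "\<pi> 0"]] by (simp flip: comp_assoc)
    then have "front_cycle (\<pi> 0) \<circ> lift_perm m (?unlift (Hilbert_Choice.inv (front_cycle (\<pi> 0)) \<circ> \<pi>)) = \<pi>"
      using un[OF \<pi>] by metis
    then show "?f (?g \<pi>) = \<pi>"
      by (simp only: prod.case)
  qed
  show "?f ` ({..m} \<times> {\<sigma>. \<sigma> permutes {..<m}}) \<subseteq> {\<pi>. \<pi> permutes {..<Suc m}}"
    by (auto intro!: permutes_compose front_cycle_permutes permutes_subset[OF lp])
  show "?g ` {\<pi>. \<pi> permutes {..<Suc m}} \<subseteq> {..m} \<times> {\<sigma>. \<sigma> permutes {..<m}}"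
    using un by auto
qed

text \<open>
  Expansion along the first letter: group the permutations by the position whose letter comes first;
  bringing the letter at position \<open>k\<close> there costs \<open>k\<close> adjacent transpositions.
\<close>

lemma signed_sum_Laplace:
  fixes g :: "'a list \<Rightarrow> 'f::comm_ring_1"
  assumes "z \<noteq> []"
  shows "signed_sum g z =
    (\<Sum>k<length z. (-1) ^ k * signed_sum (\<lambda>w. g (z ! k # w)) (remove_nth k z))"
proof (cases "length z")
  case (Suc m)
  have perm: "permute_list (front_cycle k \<circ> lift_perm m \<sigma>) z = z ! k # permute_list \<sigma> (remove_nth k z)"
    and sgn: "sign (front_cycle k \<circ> lift_perm m \<sigma>) = (-1) ^ k * sign \<sigma>"
    if "k \<le> m" "\<sigma> permutes {..<m}" for k \<sigma>
  proof -
    have p: "lift_perm m \<sigma> permutes {..<Suc m}"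
      using lift_perm_permutes[OF that(2)] by (rule permutes_subset) auto
    have l: "length (remove_nth k z) = m"
      using that Suc by simp
    show "permute_list (front_cycle k \<circ> lift_perm m \<sigma>) z = z ! k # permute_list \<sigma> (remove_nth k z)"
      using p that Suc permute_list_lift_perm[of \<sigma> "remove_nth k z" "z ! k"] l
      by (simp add: permute_list_compose permute_list_front_cycle)
    show "sign (front_cycle k \<circ> lift_perm m \<sigma>) = (-1) ^ k * sign \<sigma>"
      using p that front_cycle_permutes[of k "Suc m"]
      by (simp add: sign_compose permutation_of_permutes_lessThan sign_front_cycle)
         (simp add: lift_perm_def sign_map_permutation)
  qed
  have "signed_sum g z = (\<Sum>(k, \<sigma>)\<in>{..m} \<times> {\<sigma>. \<sigma> permutes {..<m}}.
      of_int (sign (front_cycle k \<circ> lift_perm m \<sigma>)) * g (permute_list (front_cycle k \<circ> lift_perm m \<sigma>) z))"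
    unfolding signed_sum_def Suc
    by (subst sum.reindex_bij_betw[OF bij_betw_permutes_front_cycle, symmetric])
       (simp add: case_prod_unfold)
  also have "\<dots> = (\<Sum>(k, \<sigma>)\<in>{..m} \<times> {\<sigma>. \<sigma> permutes {..<m}}.
      (-1) ^ k * (of_int (sign \<sigma>) * g (z ! k # permute_list \<sigma> (remove_nth k z))))"
    by (rule sum.cong) (auto simp: perm sgn mult.assoc)
  also have "\<dots> = (\<Sum>k\<le>m. (-1) ^ k * signed_sum (\<lambda>w. g (z ! k # w)) (remove_nth k z))"
    by (simp add: sum.cartesian_product[symmetric] signed_sum_def Suc sum_distrib_left)
  finally show ?thesis
    by (simp add: Suc lessThan_Suc_atMost)
qed (use assms in simp)

lemma signed_sum_cong:
  "(\<And>\<sigma>. \<sigma> permutes {..<length z} \<Longrightarrow> g (permute_list \<sigma> z) = h (permute_list \<sigma> z)) \<Longrightarrow>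
     signed_sum g z = signed_sum h z"
  by (simp add: signed_sum_def)

lemma signed_sum_mult: "signed_sum (\<lambda>w. c * g w) z = c * signed_sum g z"
  by (simp add: signed_sum_def sum_distrib_left mult.left_commute)

lemma signed_sum_diff: "signed_sum (\<lambda>w. g w - h w) z = signed_sum g z - signed_sum h z"
  by (simp add: signed_sum_def right_diff_distrib sum_subtractf)

lemma signed_sum_swap:
  "signed_sum (\<lambda>w. signed_sum (\<lambda>w'. F w w') z') z = signed_sum (\<lambda>w'. signed_sum (\<lambda>w. F w w') z) z'"
  unfolding signed_sum_def sum_distrib_left
  by (subst sum.swap) (simp add: mult.left_commute)

lemma signed_sum_leading:
  "signed_sum g z = g z +
     (\<Sum>\<sigma>\<in>{\<sigma>. \<sigma> permutes {..<length z}} - {id}. of_int (sign \<sigma>) * g (permute_list \<sigma> z))"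
  unfolding signed_sum_def
  by (subst sum.remove[of _ id]) (auto simp: permutes_id finite_permutations)

text \<open>
  The left side is the expansion of \<open>h\<close> along the first letter, the right side that of \<open>h\<close> after moving
  the first letter to the end. This move is a cycle of odd length, so it does not change
  the alternating sum.
\<close>

lemma signed_sum_Laplace_exchange:
  fixes h :: "'a list \<Rightarrow> 'f::comm_ring_1"
  assumes "odd (length z)"
  shows "(\<Sum>k<length z. (-1) ^ k * signed_sum (\<lambda>w. h (z ! k # w)) (remove_nth k z)) =
         (\<Sum>k<length z. (-1) ^ k * signed_sum (\<lambda>w. h (w @ [z ! k])) (remove_nth k z))"
proof -
  let ?m = "length z - 1"
  let ?rot = "\<lambda>w. h (rotate1 w)"
  have z: "z \<noteq> []" and sgn: "sign (front_cycle ?m) = 1"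
    using assms by (auto simp: sign_front_cycle)
  then have m: "?m < length z"
    by simp
  have "signed_sum ?rot z = signed_sum (\<lambda>w. ?rot (permute_list (front_cycle ?m) w)) z"
    using signed_sum_comp_permute_list[OF front_cycle_permutes[OF m], of ?rot, unfolded sgn] by simp
  also have "\<dots> = signed_sum h z"
    using z by (intro signed_sum_cong arg_cong[where f = h])
      (simp add: permute_list_front_cycle remove_nth_def take_Suc_conv_app_nth[symmetric])
  finally have "signed_sum h z = signed_sum ?rot z" ..
  then show ?thesis
    using z by (simp add: signed_sum_Laplace)
qed

section \<open>The order on words\<close>

text \<open>
  The number of pairs of positions \<open>i < j\<close> with a strictly smaller letter at \<open>i\<close>. Rearranging a factor
  does not change the contribution of pairs with a position outside the factor, and the increasing
  arrangement of distinct letters alone attains the maximum inside, so this number decreases whenever an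
  increasing factor is disarranged.
\<close>

fun noninversions :: "'a::linorder list \<Rightarrow> nat" where
  "noninversions [] = 0"
| "noninversions (x # xs) = length (filter ((<) x) xs) + noninversions xs"

lemma noninversions_append:
  "noninversions (xs @ ys) = noninversions xs + noninversions ys +
     (\<Sum>x\<in>#mset xs. size (filter_mset ((<) x) (mset ys)))"
  by (induction xs) (auto simp flip: size_mset mset_filter)

lemma noninversions_bound: "noninversions xs \<le> \<Sum>{..<length xs}"
proof (induction xs)
  case (Cons x xs)
  then show ?case
    using add_mono[OF length_filter_le[of "(<) x" xs] Cons.IH] by (simp add: add.commute)
qed simp

lemma noninversions_eq_bound_iff: "noninversions xs = \<Sum>{..<length xs} \<longleftrightarrow> sorted_wrt (<) xs"
proof (induction xs)
  case (Cons x xs)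
  have "length (filter ((<) x) xs) = length xs \<longleftrightarrow> (\<forall>y\<in>set xs. x < y)"
    by (metis filter_True length_filter_less less_irrefl)
  moreover have "noninversions (x # xs) = \<Sum>{..<length (x # xs)} \<longleftrightarrow>
      length (filter ((<) x) xs) = length xs \<and> noninversions xs = \<Sum>{..<length xs}"
  proof -
    have "\<Sum>{..<length (x # xs)} = length xs + \<Sum>{..<length xs}"
      by (simp add: add.commute)
    then show ?thesis
      using length_filter_le[of "(<) x" xs] noninversions_bound[of xs] unfolding noninversions.simps by arith
  qed
  ultimately show ?case
    using Cons.IH by simp
qed simp

lemma noninversions_less:
  assumes "sorted_wrt (<) w" "mset w' = mset w" "w' \<noteq> w"
  shows "noninversions (p @ w' @ q) < noninversions (p @ w @ q)"
proof -
  have len: "length w' = length w"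
    using assms(2) by (rule mset_eq_length)
  have "\<not> sorted_wrt (<) w'"
    using assms by (metis strict_sorted_equal mset_eq_setD)
  then have "noninversions w' < noninversions w"
    using assms(1) len noninversions_bound[of w'] noninversions_eq_bound_iff[of w'] noninversions_eq_bound_iff[of w]
    by simp
  then show ?thesis
    using assms(2) by (simp add: noninversions_append)
qed

definition word_order :: "('a::linorder list \<times> 'a list) set" where
  "word_order = measures [length, noninversions]"

lemma wf_word_order: "wf word_order"
  by (simp add: word_order_def)

lemma trans_word_order: "trans word_order"
  by (auto simp: word_order_def trans_def)

lemma word_order_rearranged:
  assumes "sorted_wrt (<) w" "mset w' = mset w" "w' \<noteq> w"
  shows "(p @ w' @ q, p @ w @ q) \<in> word_order"
  using noninversions_less[OF assms] assms(2) by (auto simp: word_order_def dest: mset_eq_length)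

lemma word_order_shorter: "length y < length x \<Longrightarrow> (y, x) \<in> word_order"
  by (simp add: word_order_def)

lemma permute_list_neq:
  assumes "distinct w" "\<sigma> permutes {..<length w}" "\<sigma> \<noteq> id"
  shows "permute_list \<sigma> w \<noteq> w"
proof
  assume eq: "permute_list \<sigma> w = w"
  have "\<sigma> i = i" if "i < length w" for i
    using that assms(1,2) arg_cong[OF eq, of "\<lambda>v. v ! i"] permutes_in_image[OF assms(2), of i]
    by (simp add: permute_list_nth nth_eq_iff_index_eq)
  then have "\<sigma> = id"
    using assms(2) by (auto simp: permutes_def fun_eq_iff)
  with assms(3) show False ..
qed

lemma word_order_permute_list:
  assumes "sorted_wrt (<) w" "\<sigma> permutes {..<length w}" "\<sigma> \<noteq> id"
  shows "(p @ permute_list \<sigma> w @ q, p @ w @ q) \<in> word_order"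
  using assms by (intro word_order_rearranged permute_list_neq) (auto simp: strict_sorted_iff)

lemma mset_remove_nth:
  assumes "k < length z" shows "add_mset (z ! k) (mset (remove_nth k z)) = mset z"
  using mset_permute_list[OF front_cycle_permutes[OF assms]] by (simp add: permute_list_front_cycle assms)

lemma set_remove_nth:
  assumes "distinct z" "k < length z"
  shows "set (remove_nth k z) = set z - {z ! k}"
proof -
  have "mset (z ! k # remove_nth k z) = mset z"
    using mset_remove_nth[OF assms(2)] by simp
  then have "distinct (z ! k # remove_nth k z)" "set (z ! k # remove_nth k z) = set z"
    using assms(1) mset_eq_imp_distinct_iff mset_eq_setD by metis+
  then show ?thesis by auto
qed

lemma nth_in_remove_nth:
  assumes "distinct z" "i < length z" "j < length z"
  shows "z ! i \<in> set (remove_nth j z) \<longleftrightarrow> i \<noteq> j"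
  using assms by (simp add: set_remove_nth nth_eq_iff_index_eq)

lemma set_remove_nth_subset: "set (remove_nth k z) \<subseteq> set z"
  unfolding remove_nth_def by (auto dest: in_set_takeD in_set_dropD)

lemma sorted_remove_nth: "sorted_wrt (<) z \<Longrightarrow> sorted_wrt (<) (remove_nth k z)"
  unfolding remove_nth_def using sorted_wrt_append[of "(<)" "take k z" "drop k z"]
  by (auto simp: sorted_wrt_append sorted_wrt_take sorted_wrt_drop)
     (metis Suc_n_not_le_n in_set_dropD nat_le_linear set_drop_subset_set_drop subsetD)

section \<open>Confluence of the relations\<close>

locale standard_word =
  fixes z :: "'a::linorder list"
  assumes sorted: "sorted_wrt (<) z" and odd: "odd (length z)" and long: "3 \<le> length z"
begin

abbreviation block :: "nat \<Rightarrow> 'a list" where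
  "block k \<equiv> remove_nth k z"

text \<open>
  The relation attached to the omitted letter \<open>z ! k\<close>, between a left context \<open>p\<close> and a right
  context \<open>q\<close>, as a condition on a function on words. Positions in \<open>z\<close> are counted from 0, and since
  \<open>length z\<close> is odd the sign is \<open>(-1) ^ k\<close>.
\<close>

definition relation_at :: "('a list \<Rightarrow> 'f::comm_ring_1) \<Rightarrow> 'a list \<Rightarrow> nat \<Rightarrow> 'a list \<Rightarrow> bool" where
  "relation_at f p k q \<longleftrightarrow>
     signed_sum (\<lambda>w. f (p @ w @ q)) (block k) = (-1) ^ k * f (p @ [z ! k] @ q)"

definition relations_on :: "('a list \<Rightarrow> 'f::comm_ring_1) \<Rightarrow> 'a list \<Rightarrow> bool" where
  "relations_on f x \<longleftrightarrow>
     (\<forall>p k q. k < length z \<longrightarrow> x = p @ block k @ q \<longrightarrow> relation_at f p k q)"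

lemma relation_below:
  assumes "\<And>y. (y, x) \<in> word_order \<Longrightarrow> relations_on f y"
    and "(p @ block k @ q, x) \<in> word_order" "k < length z"
  shows "relation_at f p k q"
  using assms unfolding relations_on_def by blast

lemma sorted_block: "sorted_wrt (<) (block k)"
  using sorted by (rule sorted_remove_nth)

lemma distinct_word: "distinct z"
  using sorted by (simp add: strict_sorted_iff)

text \<open>
  Summing the relations over all rearrangements of both factors, in either order, reduces the double sum
  to the same value of \<open>f\<close>. All relations involved, except the given one and the claimed one, belong to
  smaller words, so the former implies the latter.
\<close>

lemma confluence_disjoint:
  fixes f :: "'a list \<Rightarrow> 'f::comm_ring_1"
  assumes below: "\<And>y. (y, p @ block i @ t @ block j @ q) \<in> word_order \<Longrightarrow> relations_on f y"
    and i: "i < length z" and j: "j < length z"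
    and given: "relation_at f p i (t @ block j @ q)"
  shows "relation_at f (p @ block i @ t) j q"
proof -
  \<comment> \<open>The defect of the relation for the second factor when the first one is rearranged to \<open>w\<close>.\<close>
  define D where "D = (\<lambda>w. signed_sum (\<lambda>w'. f (p @ w @ t @ w' @ q)) (block j)
    - (-1) ^ j * f (p @ w @ t @ [z ! j] @ q))"
  have lt: "length [z ! k] < length (block k)" if "k < length z" for k
    using that long by simp
  have i_rel: "signed_sum (\<lambda>w. f (p @ w @ t @ permute_list \<tau> (block j) @ q)) (block i) =
      (-1) ^ i * f (p @ [z ! i] @ t @ permute_list \<tau> (block j) @ q)"
    if \<tau>: "\<tau> permutes {..<length (block j)}" for \<tau>
  proof (cases "\<tau> = id")
    case False
    have "(p @ block i @ t @ permute_list \<tau> (block j) @ q, p @ block i @ t @ block j @ q) \<in> word_order"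
      using word_order_permute_list[OF sorted_block \<tau> False, of "p @ block i @ t" q] by simp
    then show ?thesis
      using relation_below[OF below, where p = p and k = i and q = "t @ permute_list \<tau> (block j) @ q"] i
      by (simp add: relation_at_def)
  qed (use given in \<open>simp add: relation_at_def\<close>)
  have j_rel: "relation_at f (p @ [z ! i] @ t) j q"
    using lt[OF i] j by (intro relation_below[OF below word_order_shorter]) auto
  have i_rel': "relation_at f p i (t @ [z ! j] @ q)"
    using lt[OF j] i by (intro relation_below[OF below word_order_shorter]) auto
  have "signed_sum (\<lambda>w. signed_sum (\<lambda>w'. f (p @ w @ t @ w' @ q)) (block j)) (block i)
      = signed_sum (\<lambda>w'. (-1) ^ i * f (p @ [z ! i] @ t @ w' @ q)) (block j)"
    by (subst signed_sum_swap, rule signed_sum_cong, rule i_rel)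
  also have "\<dots> = (-1) ^ i * ((-1) ^ j * f (p @ [z ! i] @ t @ [z ! j] @ q))"
    using j_rel by (simp add: signed_sum_mult relation_at_def)
  finally have "signed_sum D (block i) = 0"
    using i_rel' by (simp add: D_def signed_sum_diff signed_sum_mult relation_at_def mult_ac)
  moreover have "D (permute_list \<sigma> (block i)) = 0"
    if \<sigma>: "\<sigma> permutes {..<length (block i)}" "\<sigma> \<noteq> id" for \<sigma>
  proof -
    have "(p @ permute_list \<sigma> (block i) @ t @ block j @ q, p @ block i @ t @ block j @ q) \<in> word_order"
      using word_order_permute_list[OF sorted_block \<sigma>] .
    then have "relation_at f (p @ permute_list \<sigma> (block i) @ t) j q"
      using j by (intro relation_below[OF below]) auto
    then show ?thesis
      by (simp add: D_def relation_at_def)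
  qed
  ultimately have "D (block i) = 0"
    by (subst (asm) signed_sum_leading) simp
  then show ?thesis
    by (simp add: D_def relation_at_def)
qed

text \<open>
  Expand the alternating sum over all rearrangements of \<open>z\<close> along the first and along the last letter.
  The terms use the relations with \<open>z ! k\<close> standing before or behind the factor, and apart from the
  given relation and the claimed one these belong to smaller words. Both right sides are multiples
  of \<open>f (p @ [z ! k, z ! k] @ q)\<close> that agree term by term.
\<close>

lemma confluence_overlap:
  fixes f :: "'a list \<Rightarrow> 'f::comm_ring_1"
  assumes below: "\<And>y. (y, p @ z @ q) \<in> word_order \<Longrightarrow> relations_on f y"
    and given: "relation_at f p (length z - 1) (last z # q)"
  shows "relation_at f (p @ [hd z]) 0 q"
proof -
  define m where "m = length z"
  have m: "0 < m" using long unfolding m_def by linarith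
  have "z \<noteq> []" using long by (metis list.size(3) not_numeral_le_zero)
  then have hd: "hd z = z ! 0" and last: "last z = z ! (m - 1)"
    by (auto simp: m_def hd_conv_nth last_conv_nth)
  \<comment> \<open>The signed defect of the relation for \<open>z ! k\<close> when that letter stands first.\<close>
  define d where "d = (\<lambda>k. (-1) ^ k *
    (signed_sum (\<lambda>w. f (p @ (z ! k # w) @ q)) (block k) - (-1) ^ k * f (p @ [z ! k, z ! k] @ q)))"
  have last_rel: "relation_at f p k (z ! k # q)" if k: "k < m" for k
  proof (cases "k = m - 1")
    case False
    have "block k @ [z ! k] \<noteq> z"
    proof
      assume "block k @ [z ! k] = z"
      then have "last z = z ! k" by (metis last_snoc)
      then show False
        using False k distinct_word last by (simp add: m_def nth_eq_iff_index_eq)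
    qed
    then have "(p @ (block k @ [z ! k]) @ q, p @ z @ q) \<in> word_order"
      using mset_remove_nth[of k z] k by (intro word_order_rearranged sorted) (simp_all add: m_def)
    then show ?thesis
      using k by (intro relation_below[OF below]) (auto simp: m_def)
  qed (use given last in \<open>simp add: m_def\<close>)
  have first_rel: "d k = 0" if k: "k < m" "k \<noteq> 0" for k
  proof -
    have "z ! k # block k \<noteq> z"
    proof
      assume "z ! k # block k = z"
      then have "z ! 0 = z ! k" by (metis nth_Cons_0)
      then show False
        using k m nth_eq_iff_index_eq[OF distinct_word, of 0 k] unfolding m_def by blast
    qed
    then have "(p @ (z ! k # block k) @ q, p @ z @ q) \<in> word_order"
      using mset_remove_nth[of k z] k by (intro word_order_rearranged sorted) (simp_all add: m_def)
    then have "relation_at f (p @ [z ! k]) k q"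
      using k by (intro relation_below[OF below]) (auto simp: m_def)
    then show ?thesis
      by (simp add: d_def relation_at_def)
  qed
  have "(\<Sum>k<m. (-1) ^ k * signed_sum (\<lambda>w. f (p @ (z ! k # w) @ q)) (block k)) =
        (\<Sum>k<m. (-1) ^ k * signed_sum (\<lambda>w. f (p @ (w @ [z ! k]) @ q)) (block k))"
    unfolding m_def using odd by (rule signed_sum_Laplace_exchange)
  also have "\<dots> = (\<Sum>k<m. (-1) ^ k * ((-1) ^ k * f (p @ [z ! k, z ! k] @ q)))"
    using last_rel by (simp add: relation_at_def)
  finally have "(\<Sum>k<m. d k) = 0"
    by (simp add: d_def right_diff_distrib sum_subtractf)
  moreover have "(\<Sum>k<m. d k) = d 0"
    using m first_rel by (subst sum.remove[of _ 0]) auto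
  ultimately have "d 0 = 0" by simp
  then show ?thesis
    by (simp add: d_def relation_at_def hd)
qed

text \<open>
  Two properly overlapping factors of this kind form together an increasing word in the letters of
  \<open>z\<close> that is longer than \<open>length z - 1\<close>. Hence this word is \<open>z\<close>, the first factor lacks its last
  letter and the second factor its first letter.
\<close>

lemma confluence:
  fixes f :: "'a list \<Rightarrow> 'f::comm_ring_1"
  assumes below: "\<And>y. (y, p @ block i @ q) \<in> word_order \<Longrightarrow> relations_on f y"
    and i: "i < length z" and j: "j < length z"
    and given: "relation_at f p i q"
    and eq: "p @ block i @ q = p' @ block j @ q'" and le: "length p \<le> length p'"
  shows "relation_at f p' j q'"
proof -
  have "take (length p) p' = p"
    using arg_cong[OF eq, of "take (length p)"] le by simp
  then obtain s where p': "p' = p @ s"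
    by (metis append_take_drop_id)
  with eq have eq': "block i @ q = s @ block j @ q'"
    by simp
  then consider
      (disjoint) t where "s = block i @ t" "q = t @ block j @ q'"
    | (overlap) v where "block i = s @ v" "v \<noteq> []" "v @ q = block j @ q'"
    unfolding append_eq_append_conv2[of "block i"] by (metis append_Nil append_Nil2)
  then show ?thesis
  proof cases
    case disjoint
    then show ?thesis
      using confluence_disjoint[of p i t j q' f] below i j given by (simp add: p')
  next
    case overlap
    show ?thesis
    proof (cases "s = []")
      case True
      then have "block i = block j \<and> q = q'"
        using overlap i j by (metis append_Nil append_eq_append_conv length_remove_nth)
      moreover have "i = j"
        using calculation nth_in_remove_nth[OF distinct_word i i] nth_in_remove_nth[OF distinct_word i j] by auto
      ultimately show ?thesis
        using given True by (simp add: p')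
    next
      case False
      have len: "length (block i) = length z - 1" "length (block j) = length z - 1"
        using i j by auto
      then have "length v \<le> length (block j)"
        using overlap(1) by (metis length_append le_add2)
      then have "take (length v) (block j) = v"
        using arg_cong[OF overlap(3), of "take (length v)"] by simp
      then obtain u where u: "block j = v @ u"
        by (metis append_take_drop_id)
      with overlap(3) have u': "q = u @ q'"
        by simp
      have lu: "length u = length s"
        using len u overlap(1) by simp
      have sorted': "sorted_wrt (<) (s @ v @ u)"
      proof -
        have sv: "sorted_wrt (<) (s @ v)" and vu: "sorted_wrt (<) (v @ u)"
          using sorted_block[of i] sorted_block[of j] overlap(1) u by simp_all
        have "x < y" if "x \<in> set s" "y \<in> set u" for x y
          using that sv vu \<open>v \<noteq> []\<close> hd_in_set[of v] less_trans[of x "hd v" y]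
          unfolding sorted_wrt_append by blast
        then show ?thesis
          using sv vu by (auto simp: sorted_wrt_append)
      qed
      have sub: "set (s @ v @ u) \<subseteq> set z"
        using set_remove_nth_subset[of i z] set_remove_nth_subset[of j z] unfolding overlap(1) u by auto
      have dist: "distinct (s @ v @ u)"
        using sorted' by (simp add: strict_sorted_iff)
      have "length (s @ v @ u) \<le> length z"
        using card_mono[OF finite_set sub] distinct_card[OF dist] distinct_card[OF distinct_word] by simp
      moreover have "length (s @ v @ u) = length z - 1 + length s"
        using len overlap(1) lu by simp
      moreover have "0 < length s" using False by simp
      ultimately have ls: "length s = 1" and ltot: "length (s @ v @ u) = length z"
        using long by linarith+
      then have "set (s @ v @ u) = set z"
        using card_subset_eq[OF finite_set sub] distinct_card[OF dist] distinct_card[OF distinct_word]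
        by simp
      then have z: "z = s @ v @ u"
        using sorted sorted' strict_sorted_equal by metis
      obtain a b where ab: "s = [a]" "u = [b]"
        using ls lu by (metis One_nat_def length_0_conv length_Suc_conv)
      then have za: "z ! 0 = a" and zb: "z ! (length z - 1) = b" and abv: "a \<notin> set (v @ u)" "b \<notin> set (s @ v)"
        using z dist by (auto simp: nth_append)
      have "i = length z - 1"
        using nth_in_remove_nth[OF distinct_word, of "length z - 1" i] i long abv(2) zb overlap(1) by auto
      moreover have "0 < length z"
        using long by linarith
      then have "j = 0"
        using nth_in_remove_nth[OF distinct_word, of 0 j] j abv(1) za u by auto
      moreover have "p @ block i @ q = p @ z @ q'"
        using z u' overlap(1) by simp
      ultimately show ?thesis
        using confluence_overlap[of p q' f] below given z ab u' by (simp add: p')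
    qed
  qed
qed

text \<open>
  The relation solved for the value at \<open>p @ block k @ q\<close>, its largest word.
\<close>

definition resolved :: "('a list \<Rightarrow> 'f::comm_ring_1) \<Rightarrow> 'a list \<Rightarrow> nat \<Rightarrow> 'a list \<Rightarrow> 'f" where
  "resolved f p k q = (-1) ^ k * f (p @ [z ! k] @ q) -
     (\<Sum>\<sigma>\<in>{\<sigma>. \<sigma> permutes {..<length (block k)}} - {id}.
        of_int (sign \<sigma>) * f (p @ permute_list \<sigma> (block k) @ q))"

lemma relation_at_iff_resolved: "relation_at f p k q \<longleftrightarrow> f (p @ block k @ q) = resolved f p k q"
  unfolding relation_at_def resolved_def by (subst signed_sum_leading) (auto simp: algebra_simps)

lemma resolved_cong:
  assumes "\<And>y. (y, p @ block k @ q) \<in> word_order \<Longrightarrow> f y = g y" and k: "k < length z"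
  shows "resolved f p k q = resolved g p k q"
proof -
  have "(p @ [z ! k] @ q, p @ block k @ q) \<in> word_order"
    using k long by (intro word_order_shorter) auto
  then show ?thesis
    unfolding resolved_def using assms word_order_permute_list[OF sorted_block]
    by (intro arg_cong2[where f = "(-)"] sum.cong) auto
qed

definition irreducible_word :: "'a list \<Rightarrow> bool" where
  "irreducible_word x \<longleftrightarrow> (\<nexists>p k q. k < length z \<and> x = p @ block k @ q)"

text \<open>
  Well-founded recursion along \<open>word_order\<close>: at an irreducible word the value is prescribed, at any other
  word it is forced by each factor \<open>block k\<close>, consistently by confluence. Comparing with the leftmost
  factor spares the symmetric case of the overlap.
\<close>

theorem extend_from_irreducible_words:
  fixes d :: "'a list \<Rightarrow> 'f::comm_ring_1"
  obtains f where "\<And>p k q. k < length z \<Longrightarrow> relation_at f p k q"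
    and "\<And>x. irreducible_word x \<Longrightarrow> f x = d x"
proof -
  define P where "P = (\<lambda>(f :: 'a list \<Rightarrow> 'f) x r.
    (\<forall>p k q. k < length z \<longrightarrow> x = p @ block k @ q \<longrightarrow> r = resolved f p k q) \<and>
    (irreducible_word x \<longrightarrow> r = d x))"
  have "\<exists>f. \<forall>x. P f x (f x)"
  proof (rule dependent_wf_choice[OF wf_word_order])
    fix f g :: "'a list \<Rightarrow> 'f" and x r
    assume "\<And>y. (y, x) \<in> word_order \<Longrightarrow> f y = g y"
    then show "P f x r = P g x r"
      unfolding P_def using resolved_cong[of _ _ _ f g] by (intro arg_cong2[where f = "(\<and>)"]) auto
  next
    fix x and f :: "'a list \<Rightarrow> 'f"
    assume IH: "\<And>y. (y, x) \<in> word_order \<Longrightarrow> P f y (f y)"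
    show "\<exists>r. P f x r"
    proof (cases "irreducible_word x")
      case True
      then have "P f x (d x)"
        by (auto simp: P_def irreducible_word_def)
      then show ?thesis ..
    next
      case False
      then have "\<exists>p. \<exists>k q. k < length z \<and> x = p @ block k @ q"
        by (auto simp: irreducible_word_def)
      then obtain p where "\<exists>k q. k < length z \<and> x = p @ block k @ q"
        and first: "\<And>p' k q. k < length z \<Longrightarrow> x = p' @ block k @ q \<Longrightarrow> length p \<le> length p'"
        using ex_has_least_nat[of "\<lambda>p. \<exists>k q. k < length z \<and> x = p @ block k @ q" _ length] by blast
      then obtain i q where i: "i < length z" and x: "x = p @ block i @ q"
        by blast
      \<comment> \<open>Confluence speaks of a function that already satisfies the leftmost relation at \<open>x\<close>.\<close>
      define g where "g = f(x := resolved f p i q)"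
      have g: "g y = f y" if "(y, x) \<in> word_order" for y
        using that wf_not_refl[OF wf_word_order] by (auto simp: g_def)
      have below: "relations_on g y" if y: "(y, x) \<in> word_order" for y
        unfolding relations_on_def
      proof clarify
        fix p' k q' assume k: "k < length z" and y': "y = p' @ block k @ q'"
        have "g u = f u" if "(u, y) \<in> word_order" for u
          using g transD[OF trans_word_order that y] .
        then have "resolved g p' k q' = resolved f p' k q'"
          using k unfolding y' by (intro resolved_cong)
        then show "relation_at g p' k q'"
          using IH[OF y] g[OF y] k y' by (simp add: relation_at_iff_resolved P_def)
      qed
      have res_g: "resolved g p' k q' = resolved f p' k q'" if "k < length z" "x = p' @ block k @ q'" for p' k q'
        using that g by (intro resolved_cong) auto
      have "relation_at g p i q"
        using res_g[OF i x] x by (simp add: relation_at_iff_resolved g_def)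
      then have "relation_at g p' j q'" if "j < length z" "x = p' @ block j @ q'" for p' j q'
        using that first[OF that] below x i by (intro confluence[of p i q g j p' q']) auto
      then have "P f x (g x)"
        using False res_g by (auto simp: P_def relation_at_iff_resolved)
      then show ?thesis ..
    qed
  qed
  then obtain f where "\<And>x. P f x (f x)" by blast
  then show thesis
    by (intro that[of f]) (auto simp: P_def relation_at_iff_resolved)
qed

lemma irreducible_letter: "irreducible_word [a]"
proof -
  have False if "k < length z" "[a] = p @ block k @ q" for p k q
    using that(1) arg_cong[OF that(2), of length] long by simp
  then show ?thesis
    by (auto simp: irreducible_word_def)
qed

end

section \<open>Alternating multilinear functions\<close>

lemma field_two_neq_0: "CHAR('f::field) \<noteq> 2 \<Longrightarrow> (2::'f) \<noteq> 0"
proof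
  assume "CHAR('f) \<noteq> 2" "(2::'f) = 0"
  moreover from this(2) have "CHAR('f) dvd 2"
    using of_nat_eq_0_iff_char_dvd[where ?'a = 'f, of 2] by simp
  moreover from this have "CHAR('f) \<le> 2" "CHAR('f) \<noteq> 0"
    by (auto dest: dvd_imp_le intro!: Nat.gr0I)
  ultimately have "CHAR('f) = 1" by linarith
  then show False
    by simp
qed

context vector_space
begin

text \<open>
  By multilinearity the values on basis vectors decide. With repeated basis vectors
  skew-symmetry gives \<open>2 * \<beta> zs = 0\<close>; otherwise \<open>n\<close> of the \<open>n + 1\<close> basis vectors occur once
  each, so the list is a rearrangement of one of those in which a single basis vector is omitted.
\<close>

lemma skew_multilinear_eq_0:
  fixes \<beta> :: "'b list \<Rightarrow> 'a" and e :: "'i \<Rightarrow> 'b"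
  assumes two: "(2::'a) \<noteq> 0"
    and add: "\<And>zs i x y. length zs = n \<Longrightarrow> i < n \<Longrightarrow> \<beta> (zs[i := x + y]) = \<beta> (zs[i := x]) + \<beta> (zs[i := y])"
    and scl: "\<And>zs i c x. length zs = n \<Longrightarrow> i < n \<Longrightarrow> \<beta> (zs[i := scale c x]) = c * \<beta> (zs[i := x])"
    and skew: "\<And>zs \<sigma>. length zs = n \<Longrightarrow> \<sigma> permutes {..<n} \<Longrightarrow> \<beta> (permute_list \<sigma> zs) = of_int (sign \<sigma>) * \<beta> zs"
    and span: "span (e ` set z) = UNIV"
    and z: "distinct z" "length z = Suc n"
    and blocks: "\<And>k. k < length z \<Longrightarrow> \<beta> (map e (remove_nth k z)) = 0"
    and zs: "length zs = n"
  shows "\<beta> zs = 0"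
proof -
  have basis: "\<beta> zs = 0" if len: "length zs = n" and sub: "set zs \<subseteq> e ` set z" for zs
  proof -
    obtain w where w: "zs = map e w" "set w \<subseteq> set z"
    proof -
      have "zs \<in> lists (e ` set z)"
        using sub by auto
      then show thesis
        using that unfolding lists_image by auto
    qed
    with len have lw: "length w = n" by simp
    show ?thesis
    proof (cases "distinct w")
      case False
      then obtain i j where ij: "i < n" "j < n" "i \<noteq> j" "w ! i = w ! j"
        using lw by (auto simp: distinct_conv_nth)
      have \<tau>: "transpose i j permutes {..<n}"
        using ij by (intro permutes_swap_id) auto
      have "permute_list (transpose i j) zs = zs"
        using \<tau> ij lw by (intro nth_equalityI) (auto simp: w permute_list_nth transpose_def)
      then have "\<beta> zs = - \<beta> zs"
        using skew[OF len \<tau>] ij by (simp add: sign_swap_id)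
      then have "2 * \<beta> zs = 0"
        by (metis add.right_inverse mult_2)
      then show ?thesis
        using two by simp
    next
      case True
      have "card (set z - set w) = 1"
        using w(2) z True lw by (simp add: card_Diff_subset distinct_card)
      then obtain a where a: "set z - set w = {a}"
        by (auto simp: card_1_singleton_iff)
      then obtain k where k: "k < length z" "z ! k = a"
        by (metis Diff_iff in_set_conv_nth insertI1)
      have "distinct (a # w)" "set (a # w) = set z"
        using True a w(2) by auto
      then have "mset (a # w) = mset z"
        using z(1) set_eq_iff_mset_eq_distinct by blast
      then have "mset w = mset (remove_nth k z)"
        using mset_remove_nth[OF k(1)] k(2) by (metis add_mset_add_mset_same_iff mset.simps(2))
      then obtain \<sigma> where \<sigma>: "\<sigma> permutes {..<length (remove_nth k z)}" "permute_list \<sigma> (remove_nth k z) = w"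
        using mset_eq_permutation by blast
      have lr: "length (remove_nth k z) = n"
        using k(1) z(2) by simp
      have "zs = permute_list \<sigma> (map e (remove_nth k z))"
        using \<sigma> by (simp add: w permute_list_map)
      then show ?thesis
        using skew[of "map e (remove_nth k z)" \<sigma>] blocks[OF k(1)] \<sigma> lr by simp
    qed
  qed
  \<comment> \<open>The entries before position \<open>k\<close> are arbitrary; the span argument frees one more per step.\<close>
  have "\<beta> zs = 0" if "k \<le> n" "length zs = n" "\<And>i. k \<le> i \<Longrightarrow> i < n \<Longrightarrow> zs ! i \<in> e ` set z" for k zs
    using that
  proof (induction k arbitrary: zs)
    case 0
    then show ?case
      by (intro basis) (auto simp: set_conv_nth)
  next
    case (Suc k)
    have "zs ! k \<in> span (e ` set z)"
      using span by simp
    then have "\<beta> (zs[k := zs ! k]) = 0"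
    proof (induction rule: span_induct)
      case base
      show "subspace {x. \<beta> (zs[k := x]) = 0}"
      proof (rule subspaceI)
        show "0 \<in> {x. \<beta> (zs[k := x]) = 0}"
          using scl[of zs k 0 0] Suc.prems by simp
      qed (use add[of zs k] scl[of zs k] Suc.prems in auto)
    next
      case (step x)
      show ?case
        by (rule Suc.IH) (use Suc.prems step in \<open>auto simp: nth_list_update\<close>)
    qed
    then show ?case by simp
  qed
  from this[of n zs] zs show ?thesis by simp
qed

end

section \<open>Algebras of operators\<close>

definition function_subspace :: "('w \<Rightarrow> 'f::field) set \<Rightarrow> bool" where
  "function_subspace M \<longleftrightarrow> (\<lambda>_. 0) \<in> M \<and>
     (\<forall>f\<in>M. \<forall>g\<in>M. (\<lambda>w. f w + g w) \<in> M) \<and> (\<forall>c. \<forall>f\<in>M. (\<lambda>w. c * f w) \<in> M)"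

text \<open>
  The linear operators on a space \<open>M\<close> of functions. Letting them vanish outside \<open>M\<close> represents each
  operator by exactly one total function, and the product is then plain composition, as \<open>0 \<in> M\<close>.
\<close>

definition operator_algebra ::
  "('w \<Rightarrow> 'f::field) set \<Rightarrow> ('f, ('w \<Rightarrow> 'f) \<Rightarrow> 'w \<Rightarrow> 'f) module" where
  "operator_algebra M = \<lparr>
     carrier = {T. (\<forall>f\<in>M. T f \<in> M) \<and> (\<forall>f. f \<notin> M \<longrightarrow> T f = (\<lambda>_. 0)) \<and>
       (\<forall>f\<in>M. \<forall>g\<in>M. T (\<lambda>w. f w + g w) = (\<lambda>w. T f w + T g w)) \<and>
       (\<forall>c. \<forall>f\<in>M. T (\<lambda>w. c * f w) = (\<lambda>w. c * T f w))},
     monoid.mult = (\<lambda>S T f. S (T f)),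
     one = (\<lambda>f. if f \<in> M then f else (\<lambda>_. 0)),
     ring.zero = (\<lambda>_ _. 0),
     add = (\<lambda>S T f w. S f w + T f w),
     module.smult = (\<lambda>c T f w. c * T f w)\<rparr>"

lemma operator_algebra_simps [simp]:
  "(S \<otimes>\<^bsub>operator_algebra M\<^esub> T) f = S (T f)"
  "\<one>\<^bsub>operator_algebra M\<^esub> f = (if f \<in> M then f else (\<lambda>_. 0))"
  "\<zero>\<^bsub>operator_algebra M\<^esub> f = (\<lambda>_. 0)"
  "(S \<oplus>\<^bsub>operator_algebra M\<^esub> T) f = (\<lambda>w. S f w + T f w)"
  "(c \<odot>\<^bsub>operator_algebra M\<^esub> T) f = (\<lambda>w. c * T f w)"
  by (simp_all add: operator_algebra_def)

locale function_space =
  fixes M :: "('w \<Rightarrow> 'f::field) set"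
  assumes subspace: "function_subspace M"
begin

abbreviation A where "A \<equiv> operator_algebra M"

lemma zero_M: "(\<lambda>_. 0) \<in> M"
  and add_M: "f \<in> M \<Longrightarrow> g \<in> M \<Longrightarrow> (\<lambda>w. f w + g w) \<in> M"
  and scale_M: "f \<in> M \<Longrightarrow> (\<lambda>w. c * f w) \<in> M"
  using subspace by (auto simp: function_subspace_def)

lemma operator_closed: "T \<in> carrier A \<Longrightarrow> f \<in> M \<Longrightarrow> T f \<in> M"
  and operator_outside: "T \<in> carrier A \<Longrightarrow> f \<notin> M \<Longrightarrow> T f = (\<lambda>_. 0)"
  and operator_add: "T \<in> carrier A \<Longrightarrow> f \<in> M \<Longrightarrow> g \<in> M \<Longrightarrow> T (\<lambda>w. f w + g w) = (\<lambda>w. T f w + T g w)"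
  and operator_scale: "T \<in> carrier A \<Longrightarrow> f \<in> M \<Longrightarrow> T (\<lambda>w. c * f w) = (\<lambda>w. c * T f w)"
  by (auto simp: operator_algebra_def)

lemma operatorI:
  assumes "\<And>f. f \<in> M \<Longrightarrow> T f \<in> M" "\<And>f. f \<notin> M \<Longrightarrow> T f = (\<lambda>_. 0)"
    "\<And>f g. f \<in> M \<Longrightarrow> g \<in> M \<Longrightarrow> T (\<lambda>w. f w + g w) = (\<lambda>w. T f w + T g w)"
    "\<And>c f. f \<in> M \<Longrightarrow> T (\<lambda>w. c * f w) = (\<lambda>w. c * T f w)"
  shows "T \<in> carrier A"
  using assms by (auto simp: operator_algebra_def)

lemma operator_zero: "T \<in> carrier A \<Longrightarrow> T (\<lambda>_. 0) = (\<lambda>_. 0)"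
  using operator_scale[of T "\<lambda>_. 0" 0] zero_M by simp

lemma operator_eqI:
  "S \<in> carrier A \<Longrightarrow> T \<in> carrier A \<Longrightarrow> (\<And>f w. f \<in> M \<Longrightarrow> S f w = T f w) \<Longrightarrow> S = T"
  using operator_outside by (metis ext)

lemmas operator_rules = operator_closed operator_outside operator_add operator_scale operator_zero

lemma smult_operator:
  assumes T: "T \<in> carrier A" shows "c \<odot>\<^bsub>A\<^esub> T \<in> carrier A"
  by (rule operatorI) (simp_all add: operator_rules[OF T] scale_M algebra_simps)

lemma add_operator:
  assumes S: "S \<in> carrier A" and T: "T \<in> carrier A" shows "S \<oplus>\<^bsub>A\<^esub> T \<in> carrier A"
  by (rule operatorI) (simp_all add: operator_rules[OF S] operator_rules[OF T] add_M algebra_simps)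

lemma mult_operator:
  assumes S: "S \<in> carrier A" and T: "T \<in> carrier A" shows "S \<otimes>\<^bsub>A\<^esub> T \<in> carrier A"
  by (rule operatorI) (simp_all add: operator_rules[OF S] operator_rules[OF T])

lemma zero_operator: "\<zero>\<^bsub>A\<^esub> \<in> carrier A"
  by (rule operatorI) (simp_all add: zero_M)

lemma one_operator: "\<one>\<^bsub>A\<^esub> \<in> carrier A"
  by (rule operatorI) (simp_all add: zero_M add_M scale_M)

lemmas operator_intros = smult_operator add_operator zero_operator one_operator mult_operator

lemma abelian_group_operators: "abelian_group A"
proof (rule abelian_groupI)
  fix S assume S: "S \<in> carrier A"
  have "((-1) \<odot>\<^bsub>A\<^esub> S) \<oplus>\<^bsub>A\<^esub> S = \<zero>\<^bsub>A\<^esub>"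
    by (rule ext) simp
  with S show "\<exists>T\<in>carrier A. T \<oplus>\<^bsub>A\<^esub> S = \<zero>\<^bsub>A\<^esub>"
    using smult_operator by blast
qed (auto intro!: operator_intros ext simp: add.assoc add.commute)

lemma monoid_operators: "monoid A"
proof (rule monoidI)
  fix T assume T: "T \<in> carrier A"
  show "\<one>\<^bsub>A\<^esub> \<otimes>\<^bsub>A\<^esub> T = T" "T \<otimes>\<^bsub>A\<^esub> \<one>\<^bsub>A\<^esub> = T"
    by (rule operator_eqI; use T in \<open>auto intro!: operator_intros simp: operator_closed\<close>)+
qed (auto intro!: operator_intros ext)

sublocale assoc_algebra A
proof (intro assoc_algebra.intro Module.module.intro module_axioms.intro assoc_algebra_axioms.intro ringI)
  show "cring (ring_of_type_algebra :: 'f ring)" ..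
  fix S T U assume S: "S \<in> carrier A" and T: "T \<in> carrier A" and U: "U \<in> carrier A"
  show "U \<otimes>\<^bsub>A\<^esub> (S \<oplus>\<^bsub>A\<^esub> T) = U \<otimes>\<^bsub>A\<^esub> S \<oplus>\<^bsub>A\<^esub> U \<otimes>\<^bsub>A\<^esub> T"
  proof (rule operator_eqI)
    fix f w assume f: "f \<in> M"
    show "(U \<otimes>\<^bsub>A\<^esub> (S \<oplus>\<^bsub>A\<^esub> T)) f w = (U \<otimes>\<^bsub>A\<^esub> S \<oplus>\<^bsub>A\<^esub> U \<otimes>\<^bsub>A\<^esub> T) f w"
      using operator_add[OF U operator_closed[OF S f] operator_closed[OF T f]] by simp
  qed (intro operator_intros S T U)+
next
  fix c S T assume S: "S \<in> carrier A" and T: "T \<in> carrier A"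
  show "S \<otimes>\<^bsub>A\<^esub> (c \<odot>\<^bsub>A\<^esub> T) = c \<odot>\<^bsub>A\<^esub> (S \<otimes>\<^bsub>A\<^esub> T)"
  proof (rule operator_eqI)
    fix f w assume f: "f \<in> M"
    show "(S \<otimes>\<^bsub>A\<^esub> (c \<odot>\<^bsub>A\<^esub> T)) f w = (c \<odot>\<^bsub>A\<^esub> (S \<otimes>\<^bsub>A\<^esub> T)) f w"
      using operator_scale[OF S operator_closed[OF T f]] by simp
  qed (intro operator_intros S T)+
qed (auto intro!: operator_intros ext abelian_group_operators monoid_operators
       simp: ring_of_type_algebra_def algebra_simps)

lemma finsum_operator:
  assumes "finite I" "\<And>i. i \<in> I \<Longrightarrow> T i \<in> carrier A"
  shows "(\<Oplus>\<^bsub>A\<^esub>i\<in>I. T i) f w = (\<Sum>i\<in>I. T i f w)"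
  using assms by (induction I) (simp_all add: finsum_insert Pi_def)

lemma foldr_mult_closed: "set Ts \<subseteq> carrier A \<Longrightarrow> foldr (\<otimes>\<^bsub>A\<^esub>) Ts (\<one>\<^bsub>A\<^esub>) \<in> carrier A"
  by (induction Ts) (auto intro: operator_intros)

lemma foldr_mult_apply: "f \<in> M \<Longrightarrow> foldr (\<otimes>\<^bsub>A\<^esub>) Ts (\<one>\<^bsub>A\<^esub>) f = foldr (\<lambda>T. T) Ts f"
  by (induction Ts) simp_all

lemma
  assumes Ts: "set Ts \<subseteq> carrier A"
  shows alt_closed: "alt A Ts \<in> carrier A"
    and alt_apply: "f \<in> M \<Longrightarrow> alt A Ts f w = signed_sum (\<lambda>Us. foldr (\<lambda>T. T) Us f w) Ts"
proof -
  have closed: "(of_int (sign \<sigma>)) \<odot>\<^bsub>A\<^esub> (foldr (\<otimes>\<^bsub>A\<^esub>) (permute_list \<sigma> Ts) (\<one>\<^bsub>A\<^esub>)) \<in> carrier A"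
    if "\<sigma> permutes {..<length Ts}" for \<sigma>
    using that Ts by (intro smult_operator foldr_mult_closed) simp
  then show "alt A Ts \<in> carrier A"
    unfolding alt_def by (intro finsum_closed) auto
  show "alt A Ts f w = signed_sum (\<lambda>Us. foldr (\<lambda>T. T) Us f w) Ts" if "f \<in> M"
    unfolding alt_def using closed
    by (subst finsum_operator) (auto simp: finite_permutations signed_sum_def foldr_mult_apply that)
qed

lemma foldr_apply_closed: "set Ts \<subseteq> carrier A \<Longrightarrow> f \<in> M \<Longrightarrow> foldr (\<lambda>T. T) Ts f \<in> M"
  by (induction Ts) (auto intro: operator_closed)

lemma foldr_apply_add:
  assumes "set Ts \<subseteq> carrier A" "S \<in> carrier A" "T \<in> carrier A" "f \<in> M" "j < length Ts"
  shows "foldr (\<lambda>T. T) (Ts[j := S \<oplus>\<^bsub>A\<^esub> T]) f =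
     (\<lambda>w. foldr (\<lambda>T. T) (Ts[j := S]) f w + foldr (\<lambda>T. T) (Ts[j := T]) f w)"
  using assms
proof (induction Ts arbitrary: j)
  case (Cons U Ts)
  show ?case
  proof (cases j)
    case (Suc i)
    have "foldr (\<lambda>T. T) (Ts[i := V]) f \<in> M" if "V \<in> carrier A" for V
      using Cons.prems that by (intro foldr_apply_closed) (use set_update_subset_insert in fastforce)+
    with Cons Suc show ?thesis
      by (simp add: operator_add)
  qed (simp add: fun_eq_iff)
qed simp

lemma foldr_apply_scale:
  assumes "set Ts \<subseteq> carrier A" "S \<in> carrier A" "f \<in> M" "j < length Ts"
  shows "foldr (\<lambda>T. T) (Ts[j := c \<odot>\<^bsub>A\<^esub> S]) f = (\<lambda>w. c * foldr (\<lambda>T. T) (Ts[j := S]) f w)"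
  using assms
proof (induction Ts arbitrary: j)
  case (Cons U Ts)
  show ?case
  proof (cases j)
    case (Suc i)
    have "foldr (\<lambda>T. T) (Ts[i := S]) f \<in> M"
      using Cons.prems by (intro foldr_apply_closed) (use set_update_subset_insert in fastforce)+
    with Cons Suc show ?thesis
      by (simp add: operator_scale)
  qed (simp add: fun_eq_iff)
qed simp

end

lemma permute_list_update:
  assumes "\<sigma> permutes {..<length zs}" "i < length zs"
  obtains j where "j < length zs" "\<And>x. permute_list \<sigma> (zs[i := x]) = (permute_list \<sigma> zs)[j := x]"
proof -
  obtain j where j: "j < length zs" "\<sigma> j = i"
    using assms permutes_image[OF assms(1)] by (metis imageE lessThan_iff)
  have "permute_list \<sigma> (zs[i := x]) = (permute_list \<sigma> zs)[j := x]" for x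
    using assms j permutes_in_image[OF assms(1)] permutes_inj[OF assms(1)]
    by (intro nth_equalityI) (auto simp: permute_list_nth nth_list_update inj_def)
  with j(1) show thesis by (rule that)
qed

context function_space
begin

lemma signed_sum_foldr_add:
  assumes "set Ts \<subseteq> carrier A" "S \<in> carrier A" "T \<in> carrier A" "f \<in> M" "i < length Ts"
  shows "signed_sum (\<lambda>Us. foldr (\<lambda>T. T) Us f w) (Ts[i := S \<oplus>\<^bsub>A\<^esub> T]) =
    signed_sum (\<lambda>Us. foldr (\<lambda>T. T) Us f w) (Ts[i := S]) +
    signed_sum (\<lambda>Us. foldr (\<lambda>T. T) Us f w) (Ts[i := T])"
  unfolding signed_sum_def length_list_update sum.distrib[symmetric]
proof (rule sum.cong)
  fix \<sigma> assume "\<sigma> \<in> {\<sigma>. \<sigma> permutes {..<length Ts}}"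
  then have \<sigma>: "\<sigma> permutes {..<length Ts}" by simp
  then obtain j where j: "j < length Ts" "\<And>x. permute_list \<sigma> (Ts[i := x]) = (permute_list \<sigma> Ts)[j := x]"
    using permute_list_update assms(5) by metis
  show "of_int (sign \<sigma>) * foldr (\<lambda>T. T) (permute_list \<sigma> (Ts[i := S \<oplus>\<^bsub>A\<^esub> T])) f w =
    of_int (sign \<sigma>) * foldr (\<lambda>T. T) (permute_list \<sigma> (Ts[i := S])) f w +
    of_int (sign \<sigma>) * foldr (\<lambda>T. T) (permute_list \<sigma> (Ts[i := T])) f w"
    using \<sigma> assms j(1) by (simp add: j(2) foldr_apply_add distrib_left)
qed simp

lemma signed_sum_foldr_scale:
  assumes "set Ts \<subseteq> carrier A" "S \<in> carrier A" "f \<in> M" "i < length Ts"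
  shows "signed_sum (\<lambda>Us. foldr (\<lambda>T. T) Us f w) (Ts[i := c \<odot>\<^bsub>A\<^esub> S]) =
    c * signed_sum (\<lambda>Us. foldr (\<lambda>T. T) Us f w) (Ts[i := S])"
  unfolding signed_sum_def length_list_update sum_distrib_left
proof (rule sum.cong)
  fix \<sigma> assume "\<sigma> \<in> {\<sigma>. \<sigma> permutes {..<length Ts}}"
  then have \<sigma>: "\<sigma> permutes {..<length Ts}" by simp
  then obtain j where j: "j < length Ts" "\<And>x. permute_list \<sigma> (Ts[i := x]) = (permute_list \<sigma> Ts)[j := x]"
    using permute_list_update assms(4) by metis
  show "of_int (sign \<sigma>) * foldr (\<lambda>T. T) (permute_list \<sigma> (Ts[i := c \<odot>\<^bsub>A\<^esub> S])) f w =
    c * (of_int (sign \<sigma>) * foldr (\<lambda>T. T) (permute_list \<sigma> (Ts[i := S])) f w)"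
    using \<sigma> assms j(1) by (simp add: j(2) foldr_apply_scale)
qed simp

end

section \<open>The embedding\<close>

lemma signed_sum_map:
  "signed_sum g (map h z) = signed_sum (\<lambda>w. g (map h w)) z"
  by (simp add: signed_sum_def permute_list_map)

context standard_word
begin

definition word_module :: "('a list \<Rightarrow> 'f::field) set" where
  "word_module = {f. \<forall>p k q. k < length z \<longrightarrow> relation_at f p k q}"

lemma function_subspace_word_module: "function_subspace (word_module :: ('a list \<Rightarrow> 'f::field) set)"
  unfolding function_subspace_def
proof (intro conjI ballI allI)
  show "(\<lambda>_. 0) \<in> (word_module :: ('a list \<Rightarrow> 'f) set)"
    by (simp add: word_module_def relation_at_def signed_sum_def)
next
  fix f g :: "'a list \<Rightarrow> 'f" assume "f \<in> word_module" "g \<in> word_module"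
  then show "(\<lambda>w. f w + g w) \<in> word_module"
    by (simp add: word_module_def relation_at_def signed_sum_def distrib_left sum.distrib)
next
  fix c and f :: "'a list \<Rightarrow> 'f" assume "f \<in> word_module"
  then show "(\<lambda>w. c * f w) \<in> word_module"
    by (simp add: word_module_def relation_at_def signed_sum_mult mult.left_commute)
qed

lemma shift_word_module: "f \<in> word_module \<Longrightarrow> (\<lambda>u. f (u @ v)) \<in> word_module"
  by (simp add: word_module_def relation_at_def)

text \<open>
  One-letter words are irreducible because every \<open>block k\<close> has at least two letters.
\<close>

lemma word_module_separates_letters:
  "\<exists>f :: 'a list \<Rightarrow> 'f::field. f \<in> word_module \<and> (\<forall>b. f [b] = (if b = a then 1 else 0))"
proof -
  obtain f :: "'a list \<Rightarrow> 'f" where "\<And>p k q. k < length z \<Longrightarrow> relation_at f p k q"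
    and "\<And>x. irreducible_word x \<Longrightarrow> f x = (if x = [a] then 1 else 0)"
    using extend_from_irreducible_words[of "\<lambda>x. if x = [a] then 1 else 0"] by metis
  then show ?thesis
    using irreducible_letter by (intro exI[of _ f]) (auto simp: word_module_def)
qed

text \<open>
  The basis vector \<open>e a\<close> goes to the operator \<open>f \<mapsto> (u \<mapsto> f (u @ [a]))\<close>. A product of such operators
  appends a whole word, so the multiplication table is the relation with empty right context. For
  injectivity, a function that is 1 at \<open>[a]\<close> and 0 at the other letters, evaluated at the empty word
  after an operator in the image has acted on it, yields the coordinate at \<open>e a\<close>.
\<close>

theorem n_lie_algebra_embeds:
  fixes scale :: "'f::field \<Rightarrow> 'v::ab_group_add \<Rightarrow> 'v" and br :: "'v list \<Rightarrow> 'v" and e :: "'a \<Rightarrow> 'v"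
  assumes L: "n_lie_algebra scale n br" and n: "length z = Suc n"
    and inj: "inj_on e (set z)"
    and indep: "\<not> Modules.module.dependent scale (e ` set z)"
    and span: "Modules.module.span scale (e ` set z) = UNIV"
    and table: "\<And>k. k < length z \<Longrightarrow> br (map e (block k)) = scale ((-1) ^ k) (e (z ! k))"
  shows "\<exists>(A :: ('f, ('a list \<Rightarrow> 'f) \<Rightarrow> 'a list \<Rightarrow> 'f) module) S \<phi>.
           assoc_algebra A \<and> minus_subalgebra n A S \<and> n_ary_iso n scale br A S \<phi>"
proof -
  interpret L: n_lie_algebra scale n br by (rule L)
  interpret W: function_space "word_module :: ('a list \<Rightarrow> 'f) set"
    by unfold_locales (rule function_subspace_word_module)
  define coord where "coord x a = L.representation (e ` set z) x (e a)" for x a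
  define \<phi> where "\<phi> x = (\<lambda>f u. if f \<in> word_module then \<Sum>a\<in>set z. coord x a * f (u @ [a]) else 0)"
    for x and f :: "'a list \<Rightarrow> 'f"
  have coord_add: "coord (x + y) a = coord x a + coord y a" for x y a
    using L.representation_add[OF indep, of y x] span by (simp add: coord_def)
  have coord_scale: "coord (scale c x) a = c * coord x a" for c x a
    using L.representation_scale[OF indep, of x c] span by (simp add: coord_def)
  have coord_basis: "coord (e b) a = (if a = b then 1 else 0)" if "a \<in> set z" "b \<in> set z" for a b
    using L.representation_basis[OF indep, of "e b"] that inj by (auto simp: coord_def inj_on_def)
  have expand: "x = (\<Sum>a\<in>set z. scale (coord x a) (e a))" for x
    using L.sum_representation_eq[OF indep, of x "e ` set z"] span
    by (simp add: coord_def sum.reindex[OF inj])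
  have \<phi>_carrier: "\<phi> x \<in> carrier W.A" for x
  proof (rule W.operatorI)
    fix f :: "'a list \<Rightarrow> 'f" assume f: "f \<in> word_module"
    have "(\<lambda>u. \<Sum>a\<in>I. coord x a * f (u @ [a])) \<in> word_module" if "finite I" for I
      using that
    proof (induction I)
      case (insert a I)
      then show ?case
        using W.add_M[OF W.scale_M[OF shift_word_module[OF f]] insert.IH, of "coord x a" "[a]"] by simp
    qed (simp add: W.zero_M)
    from this[of "set z"] f show "\<phi> x f \<in> word_module"
      by (simp add: \<phi>_def)
  qed (auto simp: \<phi>_def W.add_M W.scale_M distrib_left sum.distrib sum_distrib_left mult.left_commute)
  have \<phi>_add: "\<phi> (x + y) = \<phi> x \<oplus>\<^bsub>W.A\<^esub> \<phi> y" for x y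
    by (intro ext) (simp add: \<phi>_def coord_add distrib_right sum.distrib)
  have \<phi>_scale: "\<phi> (scale c x) = c \<odot>\<^bsub>W.A\<^esub> \<phi> x" for c x
    by (intro ext) (simp add: \<phi>_def coord_scale sum_distrib_left mult.assoc)
  have \<phi>_basis: "\<phi> (e b) f = (\<lambda>u. f (u @ [b]))" if "b \<in> set z" "f \<in> word_module" for b f
    using that by (simp add: \<phi>_def coord_basis if_distrib[of "\<lambda>c. c * _"] sum.delta' cong: if_cong)
  have \<phi>_word: "foldr (\<lambda>T. T) (map (\<phi> \<circ> e) w) f = (\<lambda>u. f (u @ w))"
    if "set w \<subseteq> set z" "f \<in> word_module" for w f
    using that by (induction w) (simp_all add: \<phi>_basis shift_word_module)
  have inj_\<phi>: "inj \<phi>"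
  proof (rule injI)
    fix x y assume eq: "\<phi> x = \<phi> y"
    have "coord x a = coord y a" if a: "a \<in> set z" for a
    proof -
      obtain f :: "'a list \<Rightarrow> 'f"
        where f: "f \<in> word_module" "\<forall>b. f [b] = (if b = a then 1 else 0)"
        using word_module_separates_letters[of a] by blast
      have "\<phi> x f [] = coord x a" for x
        using a f by (simp add: \<phi>_def if_distrib[of "\<lambda>c. _ * c"] cong: if_cong)
      then show ?thesis using eq by metis
    qed
    then have "(\<Sum>a\<in>set z. scale (coord x a) (e a)) = (\<Sum>a\<in>set z. scale (coord y a) (e a))"
      by simp
    then show "x = y"
      using expand by metis
  qed
  have hom: "\<phi> (br zs) = alt W.A (map \<phi> zs)" if zs: "length zs = n" for zs
  proof (rule W.operator_eqI)
    show "\<phi> (br zs) \<in> carrier W.A" by (rule \<phi>_carrier)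
    show "alt W.A (map \<phi> zs) \<in> carrier W.A"
      by (rule W.alt_closed) (auto simp: \<phi>_carrier)
    fix f :: "'a list \<Rightarrow> 'f" and u assume f: "f \<in> word_module"
    define g where "g = (\<lambda>Ts :: (('a list \<Rightarrow> 'f) \<Rightarrow> 'a list \<Rightarrow> 'f) list. foldr (\<lambda>T. T) Ts f u)"
    \<comment> \<open>The defect of the homomorphism property, tested at one function and one word.\<close>
    define \<beta> where "\<beta> zs = \<phi> (br zs) f u - signed_sum g (map \<phi> zs)" for zs
    have "\<beta> zs = 0"
    proof (rule L.skew_multilinear_eq_0)
      show "(2::'f) \<noteq> 0"
        using L.char_neq_2 by (rule field_two_neq_0)
      show "L.span (e ` set z) = UNIV" by (rule span)
      show "distinct z" "length z = Suc n" by (fact distinct_word n)+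
      show "length zs = n" by (rule zs)
    next
      fix xs :: "'v list" and i x y assume xs: "length xs = n" "i < n"
      have "br (xs[i := x + y]) = br (xs[i := x]) + br (xs[i := y])"
        using L.multilinear[OF xs, of 1 x 1 y] by simp
      moreover have "signed_sum g (map \<phi> (xs[i := x + y])) =
          signed_sum g (map \<phi> (xs[i := x])) + signed_sum g (map \<phi> (xs[i := y]))"
        unfolding map_update \<phi>_add g_def
        by (rule W.signed_sum_foldr_add) (use xs f in \<open>auto simp: \<phi>_carrier\<close>)
      ultimately show "\<beta> (xs[i := x + y]) = \<beta> (xs[i := x]) + \<beta> (xs[i := y])"
        by (simp add: \<beta>_def \<phi>_add)
    next
      fix xs :: "'v list" and i c x assume xs: "length xs = n" "i < n"
      have "br (xs[i := scale c x]) = scale c (br (xs[i := x]))"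
        using L.multilinear[OF xs, of c x 0 x] by simp
      moreover have "signed_sum g (map \<phi> (xs[i := scale c x])) = c * signed_sum g (map \<phi> (xs[i := x]))"
        unfolding map_update \<phi>_scale g_def
        by (rule W.signed_sum_foldr_scale) (use xs f in \<open>auto simp: \<phi>_carrier\<close>)
      ultimately show "\<beta> (xs[i := scale c x]) = c * \<beta> (xs[i := x])"
        by (simp add: \<beta>_def \<phi>_scale right_diff_distrib)
    next
      fix xs :: "'v list" and \<sigma> assume xs: "length xs = n" "\<sigma> permutes {..<n}"
      then have "map \<phi> (permute_list \<sigma> xs) = permute_list \<sigma> (map \<phi> xs)"
        by (simp add: permute_list_map)
      then show "\<beta> (permute_list \<sigma> xs) = of_int (sign \<sigma>) * \<beta> xs"
        using xs by (simp add: \<beta>_def L.skew \<phi>_scale signed_sum_permute_list right_diff_distrib)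
    next
      fix k assume k: "k < length z"
      have "signed_sum g (map \<phi> (map e (block k))) = signed_sum (\<lambda>w. f (u @ w)) (block k)"
        unfolding list.map_comp signed_sum_map
      proof (rule signed_sum_cong)
        fix \<sigma> assume "\<sigma> permutes {..<length (block k)}"
        then have "set (permute_list \<sigma> (block k)) \<subseteq> set z"
          using set_remove_nth_subset by (metis set_permute_list)
        then show "g (map (\<phi> \<circ> e) (permute_list \<sigma> (block k))) = f (u @ permute_list \<sigma> (block k))"
          using f by (simp add: g_def \<phi>_word)
      qed
      also have "\<dots> = (-1) ^ k * f (u @ [z ! k])"
      proof -
        have "relation_at f u k []"
          using f k by (simp add: word_module_def)
        then show ?thesis
          by (simp add: relation_at_def)
      qed
      also have "\<dots> = \<phi> (br (map e (block k))) f u"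
        using f k by (simp add: table \<phi>_scale \<phi>_basis)
      finally show "\<beta> (map e (block k)) = 0"
        by (simp add: \<beta>_def)
    qed
    then show "\<phi> (br zs) f u = alt W.A (map \<phi> zs) f u"
      using f by (subst W.alt_apply) (auto simp: \<beta>_def g_def \<phi>_carrier)
  qed
  have sub: "minus_subalgebra n W.A (range \<phi>)"
    unfolding minus_subalgebra_def
  proof (intro conjI allI impI)
    have closed_scale: "c \<odot>\<^bsub>W.A\<^esub> T \<in> range \<phi>" if "T \<in> range \<phi>" for c T
      using that \<phi>_scale by (metis imageE rangeI)
    show "submodule (range \<phi>) (ring_of_type_algebra :: 'f ring) W.A"
    proof (rule W.submoduleI)
      have "0 \<odot>\<^bsub>W.A\<^esub> \<phi> 0 = \<zero>\<^bsub>W.A\<^esub>"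
        by (intro ext) simp
      then have "\<phi> 0 = \<zero>\<^bsub>W.A\<^esub>"
        using \<phi>_scale[of 0 0] by simp
      then show zero: "\<zero>\<^bsub>W.A\<^esub> \<in> range \<phi>"
        by (metis rangeI)
      fix T assume T: "T \<in> range \<phi>"
      then have "T \<in> carrier W.A" using \<phi>_carrier by auto
      moreover have "(-1) \<odot>\<^bsub>W.A\<^esub> T \<oplus>\<^bsub>W.A\<^esub> T = \<zero>\<^bsub>W.A\<^esub>"
        by (intro ext) simp
      ultimately have "\<ominus>\<^bsub>W.A\<^esub> T = (-1) \<odot>\<^bsub>W.A\<^esub> T"
        using W.minus_equality W.smult_operator by metis
      then show "\<ominus>\<^bsub>W.A\<^esub> T \<in> range \<phi>"
        using closed_scale[OF T] by metis
    next
      fix S T assume "S \<in> range \<phi>" "T \<in> range \<phi>"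
      then obtain x y where "S = \<phi> x" "T = \<phi> y"
        by blast
      then have "S \<oplus>\<^bsub>W.A\<^esub> T = \<phi> (x + y)"
        by (simp only: \<phi>_add)
      then show "S \<oplus>\<^bsub>W.A\<^esub> T \<in> range \<phi>"
        by (metis rangeI)
    qed (use closed_scale \<phi>_carrier in auto)
    fix Ts assume Ts: "length Ts = n \<and> set Ts \<subseteq> range \<phi>"
    then have "Ts \<in> lists (range \<phi>)" by auto
    then obtain xs where xs: "Ts = map \<phi> xs"
      unfolding lists_image by auto
    with Ts hom[of xs] show "alt W.A Ts \<in> range \<phi>"
      by (metis length_map rangeI)
  qed
  have "n_ary_iso n scale br W.A (range \<phi>) \<phi>"
    unfolding n_ary_iso_def using inj_\<phi> \<phi>_add \<phi>_scale hom by (simp add: bij_betw_def)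
  with sub W.assoc_algebra_axioms show ?thesis
    by blast
qed

end

theorem corollary4p4:
  fixes n :: nat
    and scale :: "'f::field \<Rightarrow> 'v::ab_group_add \<Rightarrow> 'v"
    and br :: "'v list \<Rightarrow> 'v"
    and e :: "nat \<Rightarrow> 'v"
  assumes "n \<ge> 4" and "even n"
    and "CHAR('f) \<noteq> 2"
    and "n_lie_algebra scale n br"
    and "n_lie_algebra.simple scale n br"
    and "inj_on e {1..n+1}"
    and "\<not> Modules.module.dependent scale (e ` {1..n+1})"
    and "Modules.module.span scale (e ` {1..n+1}) = UNIV"
    and "\<And>i. i \<in> {1..n+1} \<Longrightarrow>
           br (map e (filter (\<lambda>j. j \<noteq> i) [1..<n+2])) = scale ((-1) ^ (n + i + 1)) (e i)"
  shows "\<exists>(A :: ('f, 'f alg_universe) module) S \<phi>.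
           assoc_algebra A \<and> minus_subalgebra n A S \<and> n_ary_iso n scale br A S \<phi>"
proof -
  define z where "z = [1..<n+2]"
  have len: "length z = Suc n" and set_z: "set z = {1..n+1}"
    by (auto simp: z_def)
  interpret standard_word z
    by unfold_locales (use assms(1,2) len in \<open>simp_all add: z_def sorted_wrt_upt del: upt_Suc\<close>)
  have "br (map e (block k)) = scale ((-1) ^ k) (e (z ! k))" if k: "k < length z" for k
  proof -
    have k': "Suc k \<in> {1..n+1}"
      using k len by simp
    have zk: "z ! k = Suc k"
      using k' by (simp add: z_def nth_upt del: upt_Suc)
    have block: "filter (\<lambda>j. j \<noteq> Suc k) [1..<n+2] = block k"
    proof (rule strict_sorted_equal)
      show "sorted_wrt (<) (filter (\<lambda>j. j \<noteq> Suc k) [1..<n+2])"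
        by (intro sorted_wrt_filter sorted_wrt_upt)
      show "sorted_wrt (<) (block k)"
        by (rule sorted_block)
      have "set (filter (\<lambda>j. j \<noteq> Suc k) [1..<n+2]) = set z - {Suc k}"
        unfolding z_def by (auto simp del: upt_Suc)
      then show "set (filter (\<lambda>j. j \<noteq> Suc k) [1..<n+2]) = set (block k)"
        by (simp only: set_remove_nth[OF distinct_word k] zk)
    qed
    have sgn: "(-1) ^ (n + Suc k + 1) = ((-1) ^ k :: 'f)"
      using assms(2) by (simp add: power_add)
    show ?thesis
      using assms(9)[OF k'] unfolding block sgn zk .
  qed
  then show ?thesis
    using n_lie_algebra_embeds[OF assms(4) len, of e] assms(6-8) unfolding set_z by blast
qed

end
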